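(* Let $(\mathcal{A}_1,\varphi_1)$ and $(\mathcal{A}_2,\varphi_2)$ be two algebraic probability spaces and assume that $\mathcal{A}_1$ has a decomposition $\mathcal{A}_1=\mathbb{C}\mathbf{1}\oplus\mathcal{A}_1^0$ (direct sum of vector spaces), where $\mathcal{A}_1^0$ is a subalgebra of $\mathcal{A}_1$. Define a unital functional $\delta_1:\mathcal{A}_1\to\mathbb{C}$ by $\delta_1(\lambda\mathbf{1}+a_0)=\lambda$ for $\lambda\in\mathbb{C}$, $a_0\in\mathcal{A}_1^0$. Then the monotone product of $\varphi_1$ and $\varphi_2$ equals the first functional of the conditionally free product of $(\mathcal{A}_1,\varphi_1,\delta_1)$ and $(\mathcal{A}_2,\varphi_2,\varphi_2)$: \[ \varphi_1\triangleright\varphi_2=\varphi_1\,{}_{\delta_1}\!*_{\varphi_2}\,\varphi_2 \] as functionals on $\mathcal{A}_1\coprod\mathcal{A}_2$.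
   Context: An algebraic probability space is a pair $(\mathcal{A},\varphi)$ of a unital complex algebra $\mathcal{A}$ and a unital linear functional $\varphi:\mathcal{A}\to\mathbb{C}$. $\mathcal{A}_1\coprod\mathcal{A}_2$ denotes the free product of the unital algebras $\mathcal{A}_1,\mathcal{A}_2$ with identification of units. Monotone product: if $\mathcal{A}_1=\mathbb{C}\mathbf{1}\oplus\mathcal{A}_1^0$ with $\mathcal{A}_1^0$ a subalgebra, then $\varphi_1\triangleright\varphi_2:\mathcal{A}_1\coprod\mathcal{A}_2\to\mathbb{C}$ is the unital linear functional determined by \[ (\varphi_1\triangleright\varphi_2)(b_1a_1b_2\cdots a_{n-1}b_n)=\varphi_1(a_1\cdots a_{n-1})\,\varphi_2(b_1)\cdots\varphi_2(b_n) \] for all $n\in\mathbb{N}$, $a_1,\ldots,a_{n-1}\in\mathcal{A}_1^0$, $b_1,\ldots,b_n\in\mathcal{A}_2$. Conditionally free product: given unital algebras with pairs of unital functionals $(\mathcal{A}_1,\varphi_1,\psi_1)$ and $(\mathcal{A}_2,\varphi_2,\psi_2)$, their conditionally free product is $(\mathcal{A}_1\coprod\mathcal{A}_2,\varphi,\psi)$, where $\varphi,\psi$ are the unital linear functionals determined by \[ \varphi(a_1a_2\cdots a_n)=\varphi_{\epsilon(1)}(a_1)\cdots\varphi_{\epsilon(n)}(a_n),\qquad \psi(a_1a_2\cdots a_n)=0 \] for all $n\in\mathbb{N}$ and all $a_i\in\mathcal{A}_{\epsilon(i)}$ with $\epsilon(i)\in\{1,2\}$, $\epsilon(1)\neq\epsilon(2)\neq\cdots\neq\epsilon(n)$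 and $\psi_{\epsilon(1)}(a_1)=\cdots=\psi_{\epsilon(n)}(a_n)=0$. The functional $\varphi$ is denoted $\varphi_1\,{}_{\psi_1}\!*_{\psi_2}\,\varphi_2$. *)

theory Defs
  imports Complex_Main "HOL-Library.Poly_Mapping"
begin

section \<open>Unital complex algebras and unital functionals\<close>

(* Built on ring and monoid_mult instead of ring_1, so that 0 = 1 is not excluded by the class:
   the free product type below can then be made an instance without further conditions.
   A unital functional forces 0 \<noteq> 1 anyway. *)
class complex_algebra_1 = ring + monoid_mult +
  fixes scaleC :: "complex \<Rightarrow> 'a \<Rightarrow> 'a"  (infixr \<open>*\<^sub>C\<close> 75)
  assumes scaleC_add_right: "c *\<^sub>C (x + y) = c *\<^sub>C x + c *\<^sub>C y"
    and scaleC_add_left: "(c + d) *\<^sub>C x = c *\<^sub>C x + d *\<^sub>C x"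
    and scaleC_scaleC: "c *\<^sub>C (d *\<^sub>C x) = (c * d) *\<^sub>C x"
    and scaleC_one: "1 *\<^sub>C x = x"
    and mult_scaleC_left: "(c *\<^sub>C x) * y = c *\<^sub>C (x * y)"
    and mult_scaleC_right: "x * (c *\<^sub>C y) = c *\<^sub>C (x * y)"

interpretation complex_alg: vector_space "scaleC :: complex \<Rightarrow> 'a \<Rightarrow> 'a::complex_algebra_1"
  by unfold_locales (simp_all add: scaleC_add_right scaleC_add_left scaleC_scaleC scaleC_one)

definition unital_functional :: "('a::complex_algebra_1 \<Rightarrow> complex) \<Rightarrow> bool" where
  "unital_functional \<phi> \<longleftrightarrow> Vector_Spaces.linear (*\<^sub>C) (*) \<phi> \<and> \<phi> 1 = 1"

(* The decomposition A = C1 \<oplus> A0, where A0 is a (not necessarily unital) subalgebra. *)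
definition unit_decomposition :: "'a::complex_algebra_1 set \<Rightarrow> bool" where
  "unit_decomposition A0 \<longleftrightarrow>
     complex_alg.subspace A0 \<and> (\<forall>x\<in>A0. \<forall>y\<in>A0. x * y \<in> A0) \<and>
     range (\<lambda>l. l *\<^sub>C 1) \<inter> A0 = {0} \<and> (\<forall>a. \<exists>l. \<exists>a0\<in>A0. a = l *\<^sub>C 1 + a0)"

definition unit_coeff :: "'a::complex_algebra_1 set \<Rightarrow> 'a \<Rightarrow> complex" where
  "unit_coeff A0 a = (THE l. \<exists>a0\<in>A0. a = l *\<^sub>C 1 + a0)"


section \<open>The free product with identification of units\<close>

(* Lists form the free monoid, hence 'c list \<Rightarrow>\<^sub>0 complex is the free unital complex algebra on 'c. *)
instantiation list :: (type) monoid_add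
begin
definition zero_list :: "'a list" where "zero_list = []"
definition plus_list :: "'a list \<Rightarrow> 'a list \<Rightarrow> 'a list" where "plus_list = (@)"
instance by standard (simp_all add: zero_list_def plus_list_def)
end

abbreviation word :: "'c list \<Rightarrow> 'c list \<Rightarrow>\<^sub>0 complex" where
  "word w \<equiv> Poly_Mapping.single w 1"

(* The least congruence on the free algebra over the disjoint union of both algebras that makes
   the two canonical maps homomorphisms of unital algebras. *)
inductive free_product_rel ::
  "(('a::complex_algebra_1 + 'b::complex_algebra_1) list \<Rightarrow>\<^sub>0 complex) \<Rightarrow> (('a + 'b) list \<Rightarrow>\<^sub>0 complex) \<Rightarrow> bool"
where
  fpr_add1: "free_product_rel (word [Inl (x + y)]) (word [Inl x] + word [Inl y])"
| fpr_add2: "free_product_rel (word [Inr (x' + y')]) (word [Inr x'] + word [Inr y'])"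
| fpr_scale1: "free_product_rel (word [Inl (c *\<^sub>C x)]) (Poly_Mapping.single [Inl x] c)"
| fpr_scale2: "free_product_rel (word [Inr (c *\<^sub>C x')]) (Poly_Mapping.single [Inr x'] c)"
| fpr_mult1: "free_product_rel (word [Inl (x * y)]) (word [Inl x, Inl y])"
| fpr_mult2: "free_product_rel (word [Inr (x' * y')]) (word [Inr x', Inr y'])"
| fpr_one1: "free_product_rel (word [Inl 1]) 1"
| fpr_one2: "free_product_rel (word [Inr 1]) 1"
| fpr_refl: "free_product_rel p p"
| fpr_sym: "free_product_rel p q \<Longrightarrow> free_product_rel q p"
| fpr_trans: "free_product_rel p q \<Longrightarrow> free_product_rel q r \<Longrightarrow> free_product_rel p r"
| fpr_add: "free_product_rel p q \<Longrightarrow> free_product_rel p' q' \<Longrightarrow> free_product_rel (p + p') (q + q')"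
| fpr_mult: "free_product_rel p q \<Longrightarrow> free_product_rel p' q' \<Longrightarrow> free_product_rel (p * p') (q * q')"

lemma word_Nil: "word [] = 1"
  by (metis single_one zero_list_def)

lemma poly_mapping_single_induct [case_names single add]:
  fixes p :: "'c \<Rightarrow>\<^sub>0 'd::comm_monoid_add"
  assumes single: "\<And>k v. P (Poly_Mapping.single k v)"
    and add: "\<And>p q. P p \<Longrightarrow> P q \<Longrightarrow> P (p + q)"
  shows "P p"
proof (induction p rule: update_induct)
  case const
  show ?case using single[of undefined 0] by simp
next
  case (update f a b)
  have "Poly_Mapping.update a b f = f + Poly_Mapping.single a b"
    using update(1) by (intro poly_mapping_eqI)
      (auto simp: lookup_add lookup_single lookup_update in_keys_iff when_def)
  then show ?case using update single add by simp
qed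

lemma scalar_mult_commute:
  fixes p :: "'c list \<Rightarrow>\<^sub>0 complex"
  shows "Poly_Mapping.single [] c * p = p * Poly_Mapping.single [] c"
  by (induction p rule: poly_mapping_single_induct)
     (simp_all add: mult_single plus_list_def algebra_simps)

quotient_type (overloaded) ('a, 'b) free_product =
  "('a::complex_algebra_1 + 'b::complex_algebra_1) list \<Rightarrow>\<^sub>0 complex" / free_product_rel
  by (intro equivpI reflpI sympI transpI) (blast intro: fpr_refl fpr_sym fpr_trans)+

instantiation free_product :: (complex_algebra_1, complex_algebra_1) complex_algebra_1
begin

lift_definition zero_free_product :: "('a, 'b) free_product" is 0 .
lift_definition one_free_product :: "('a, 'b) free_product" is 1 .
lift_definition plus_free_product ::
  "('a, 'b) free_product \<Rightarrow> ('a, 'b) free_product \<Rightarrow> ('a, 'b) free_product" is "(+)"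
  by (rule fpr_add)
lift_definition times_free_product ::
  "('a, 'b) free_product \<Rightarrow> ('a, 'b) free_product \<Rightarrow> ('a, 'b) free_product" is "(*)"
  by (rule fpr_mult)
lift_definition uminus_free_product :: "('a, 'b) free_product \<Rightarrow> ('a, 'b) free_product" is uminus
  using fpr_mult[OF fpr_refl[of "-1"]] by fastforce
lift_definition minus_free_product ::
  "('a, 'b) free_product \<Rightarrow> ('a, 'b) free_product \<Rightarrow> ('a, 'b) free_product" is "(-)"
  using fpr_add[OF _ fpr_mult[OF fpr_refl[of "-1"]]] by fastforce
lift_definition scaleC_free_product :: "complex \<Rightarrow> ('a, 'b) free_product \<Rightarrow> ('a, 'b) free_product"
  is "\<lambda>c p. Poly_Mapping.single [] c * p"
  by (rule fpr_mult[OF fpr_refl])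

instance
proof
  fix x y z :: "('a, 'b) free_product" and c d :: complex
  show "x + y + z = x + (y + z)" "x + y = y + x" "0 + x = x" "- x + x = 0" "x - y = x + - y"
    "x * y * z = x * (y * z)" "(x + y) * z = x * z + y * z" "x * (y + z) = x * y + x * z"
    "1 * x = x" "x * 1 = x"
    by (transfer, simp add: algebra_simps fpr_refl)+
  show "c *\<^sub>C (x + y) = c *\<^sub>C x + c *\<^sub>C y"
    by (transfer, simp add: algebra_simps fpr_refl)
  show "(c + d) *\<^sub>C x = c *\<^sub>C x + d *\<^sub>C x"
    by (transfer, simp add: algebra_simps single_add fpr_refl)
  show "c *\<^sub>C (d *\<^sub>C x) = (c * d) *\<^sub>C x"
    by (transfer, simp add: mult_single plus_list_def fpr_refl flip: mult.assoc)
  show "1 *\<^sub>C x = x"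
    by (transfer, simp add: word_Nil fpr_refl)
  show "(c *\<^sub>C x) * y = c *\<^sub>C (x * y)"
    by (transfer, simp add: mult.assoc fpr_refl)
  show "x * (c *\<^sub>C y) = c *\<^sub>C (x * y)"
    by (transfer, metis mult.assoc scalar_mult_commute fpr_refl)
qed

end

lift_definition fp_inj :: "'a::complex_algebra_1 + 'b::complex_algebra_1 \<Rightarrow> ('a, 'b) free_product"
  is "\<lambda>z. word [z]" .

abbreviation fp_inl :: "'a::complex_algebra_1 \<Rightarrow> ('a, 'b::complex_algebra_1) free_product" where
  "fp_inl a \<equiv> fp_inj (Inl a)"

abbreviation fp_inr :: "'b::complex_algebra_1 \<Rightarrow> ('a::complex_algebra_1, 'b) free_product" where
  "fp_inr b \<equiv> fp_inj (Inr b)"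


section \<open>Monotone and conditionally free products\<close>

(* The element b_1 a_1 b_2 ... a_(n-1) b_n is encoded by b_1 and the list ps of the n - 1 pairs
   (a_i, b_(i+1)); for n = 1 the product a_1 ... a_(n-1) is the empty product 1. *)
definition is_monotone_product ::
  "'a::complex_algebra_1 set \<Rightarrow> ('a \<Rightarrow> complex) \<Rightarrow> ('b::complex_algebra_1 \<Rightarrow> complex) \<Rightarrow>
    (('a, 'b) free_product \<Rightarrow> complex) \<Rightarrow> bool" where
  "is_monotone_product A0 \<phi>1 \<phi>2 \<mu> \<longleftrightarrow> unital_functional \<mu> \<and>
     (\<forall>b ps. fst ` set ps \<subseteq> A0 \<longrightarrow>
        \<mu> (fp_inr b * prod_list (map (\<lambda>(a, b'). fp_inl a * fp_inr b') ps)) =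
        \<phi>1 (prod_list (map fst ps)) * (\<phi>2 b * prod_list (map (\<lambda>(a, b'). \<phi>2 b') ps)))"

definition monotone_product ::
  "'a::complex_algebra_1 set \<Rightarrow> ('a \<Rightarrow> complex) \<Rightarrow> ('b::complex_algebra_1 \<Rightarrow> complex) \<Rightarrow>
    ('a, 'b) free_product \<Rightarrow> complex" where
  "monotone_product A0 \<phi>1 \<phi>2 = (THE \<mu>. is_monotone_product A0 \<phi>1 \<phi>2 \<mu>)"

(* A letter Inl a or Inr b records its index \<epsilon> together with the element of the respective algebra. *)
definition centered_alternating ::
  "('a \<Rightarrow> complex) \<Rightarrow> ('b \<Rightarrow> complex) \<Rightarrow> ('a + 'b) list \<Rightarrow> bool" where
  "centered_alternating \<psi>1 \<psi>2 w \<longleftrightarrow>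
     successively (\<lambda>x y. isl x \<noteq> isl y) w \<and> (\<forall>z\<in>set w. case_sum \<psi>1 \<psi>2 z = 0)"

definition is_cfree_product ::
  "('a::complex_algebra_1 \<Rightarrow> complex) \<Rightarrow> ('a \<Rightarrow> complex) \<Rightarrow>
    ('b::complex_algebra_1 \<Rightarrow> complex) \<Rightarrow> ('b \<Rightarrow> complex) \<Rightarrow>
    (('a, 'b) free_product \<Rightarrow> complex) \<times> (('a, 'b) free_product \<Rightarrow> complex) \<Rightarrow> bool" where
  "is_cfree_product \<phi>1 \<psi>1 \<phi>2 \<psi>2 = (\<lambda>(\<phi>, \<psi>). unital_functional \<phi> \<and> unital_functional \<psi> \<and>
     (\<forall>w. w \<noteq> [] \<longrightarrow> centered_alternating \<psi>1 \<psi>2 w \<longrightarrow>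
        \<phi> (prod_list (map fp_inj w)) = prod_list (map (case_sum \<phi>1 \<phi>2) w) \<and>
        \<psi> (prod_list (map fp_inj w)) = 0))"

definition cfree_product ::
  "('a::complex_algebra_1 \<Rightarrow> complex) \<Rightarrow> ('a \<Rightarrow> complex) \<Rightarrow>
    ('b::complex_algebra_1 \<Rightarrow> complex) \<Rightarrow> ('b \<Rightarrow> complex) \<Rightarrow>
    (('a, 'b) free_product \<Rightarrow> complex) \<times> (('a, 'b) free_product \<Rightarrow> complex)" where
  "cfree_product \<phi>1 \<psi>1 \<phi>2 \<psi>2 = (THE p. is_cfree_product \<phi>1 \<psi>1 \<phi>2 \<psi>2 p)"


section \<open>Both products are well defined\<close>

lemma linear_functional_iff:
  "Vector_Spaces.linear (*\<^sub>C) (*) (f :: 'a::complex_algebra_1 \<Rightarrow> complex) \<longleftrightarrow>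
     (\<forall>x y. f (x + y) = f x + f y) \<and> (\<forall>c x. f (c *\<^sub>C x) = c * f x)"
  by (auto simp: Vector_Spaces.linear_def module_hom_def module_hom_axioms_def
      complex_alg.vector_space_axioms complex_alg.module_axioms vector_space_def module_def
      algebra_simps)

lemma unital_functionalD:
  assumes "unital_functional f"
  shows "f (x + y) = f x + f y" "f (c *\<^sub>C x) = c * f x" "f 1 = 1" "f (x - y) = f x - f y" "f 0 = 0"
proof -
  show *: "f (x + y) = f x + f y" "f (c *\<^sub>C x) = c * f x" "f 1 = 1" for x y c
    using assms by (auto simp: unital_functional_def linear_functional_iff)
  show "f (x - y) = f x - f y" using *(1)[of "x - y" y] by (simp add: algebra_simps)
  show "f 0 = 0" using *(1)[of 0 0] by simp
qed

lemma fp_inj_simps: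
  "fp_inl (x + y) = fp_inl x + fp_inl y" "fp_inr (x' + y') = fp_inr x' + fp_inr y'"
  "fp_inl (c *\<^sub>C x) = c *\<^sub>C fp_inl x" "fp_inr (c *\<^sub>C x') = c *\<^sub>C fp_inr x'"
  "fp_inl (x * y) = fp_inl x * fp_inl y" "fp_inr (x' * y') = fp_inr x' * fp_inr y'"
  "fp_inl 1 = 1" "fp_inr 1 = 1"
  by (transfer, simp add: mult_single plus_list_def free_product_rel.intros)+

lemma fp_word: "prod_list (map fp_inj w) = abs_free_product (word w)"
  by (induction w)
     (simp_all add: word_Nil one_free_product.abs_eq fp_inj.abs_eq times_free_product.abs_eq
       mult_single plus_list_def)

lemma fp_induct [case_names word add scale]:
  assumes word: "\<And>w. P (prod_list (map fp_inj w))"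
    and add: "\<And>x y. P x \<Longrightarrow> P y \<Longrightarrow> P (x + y)"
    and scale: "\<And>c x. P x \<Longrightarrow> P (c *\<^sub>C x)"
  shows "P x"
proof -
  have "P (abs_free_product p)" for p
  proof (induction p rule: poly_mapping_single_induct)
    case (single k v)
    have "Poly_Mapping.single k v = Poly_Mapping.single [] v * word k"
      by (simp add: mult_single plus_list_def)
    then show ?case using scale[OF word, of v k]
      by (simp add: fp_word scaleC_free_product.abs_eq)
  next
    case (add p q)
    then show ?case using assms(2) by (metis plus_free_product.abs_eq)
  qed
  then show ?thesis by (metis Quotient_abs_rep Quotient_free_product)
qed

lemma fp_span:
  assumes "1 \<in> S" and step: "\<And>z s. s \<in> S \<Longrightarrow> fp_inj z * s \<in> complex_alg.span S"
  shows "complex_alg.span S = UNIV"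
proof -
  have step': "fp_inj z * m \<in> complex_alg.span S" if "m \<in> complex_alg.span S" for z m
    using that
  proof (induction rule: complex_alg.span_induct_alt)
    case base then show ?case by (simp add: complex_alg.span_zero)
  next
    case (step c s m)
    then show ?case using assms(2)
      by (simp add: algebra_simps mult_scaleC_right complex_alg.span_add complex_alg.span_scale)
  qed
  have "x \<in> complex_alg.span S" for x
  proof (induction x rule: fp_induct)
    case (word w)
    show ?case
      by (induction w) (simp_all add: step' complex_alg.span_base assms(1))
  qed (simp_all add: complex_alg.span_add complex_alg.span_scale)
  then show ?thesis by auto
qed

lemma unital_functional_eqI:
  assumes "unital_functional f" "unital_functional g" "complex_alg.span S = UNIV"
    and "\<And>s. s \<in> S \<Longrightarrow> f s = g s"
  shows "f = g"
proof
  fix x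
  have "x \<in> complex_alg.span S" using assms(3) by simp
  then show "f x = g x"
    by (induction rule: complex_alg.span_induct_alt)
       (simp_all add: assms(4) unital_functionalD[OF assms(1)] unital_functionalD[OF assms(2)])
qed

(* A family T of operators, one for each letter, on complex functions over a set R defines a
   functional on the free product if it respects the relations of the free product on R. *)
lemma fp_functional_ex:
  fixes T :: "'a::complex_algebra_1 + 'b::complex_algebra_1 \<Rightarrow> ('s \<Rightarrow> complex) \<Rightarrow> 's \<Rightarrow> complex"
  assumes G0: "G0 \<in> M" and M: "\<And>G z. G \<in> M \<Longrightarrow> T z G \<in> M" and s0: "s0 \<in> R"
    and cong: "\<And>G H z s. (\<And>s. s \<in> R \<Longrightarrow> G s = H s) \<Longrightarrow> s \<in> R \<Longrightarrow> T z G s = T z H s"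
    and lin: "\<And>c G H z s. T z (\<lambda>s. c * G s + H s) s = c * T z G s + T z H s"
    and lin1: "\<And>c x y G s. G \<in> M \<Longrightarrow> s \<in> R \<Longrightarrow>
      T (Inl (c *\<^sub>C x + y)) G s = c * T (Inl x) G s + T (Inl y) G s"
    and lin2: "\<And>c x y G s. G \<in> M \<Longrightarrow> s \<in> R \<Longrightarrow>
      T (Inr (c *\<^sub>C x + y)) G s = c * T (Inr x) G s + T (Inr y) G s"
    and mult1: "\<And>x y G s. G \<in> M \<Longrightarrow> s \<in> R \<Longrightarrow> T (Inl (x * y)) G s = T (Inl y) (T (Inl x) G) s"
    and mult2: "\<And>x y G s. G \<in> M \<Longrightarrow> s \<in> R \<Longrightarrow> T (Inr (x * y)) G s = T (Inr y) (T (Inr x) G) s"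
    and one1: "\<And>G s. G \<in> M \<Longrightarrow> s \<in> R \<Longrightarrow> T (Inl 1) G s = G s"
    and one2: "\<And>G s. G \<in> M \<Longrightarrow> s \<in> R \<Longrightarrow> T (Inr 1) G s = G s"
  shows "\<exists>f. Vector_Spaces.linear (*\<^sub>C) (*) f \<and> (\<forall>w. f (prod_list (map fp_inj w)) = fold T w G0 s0)"
proof -
  define F where "F = (\<lambda>w. fold T w G0 s0)"
  define L where "L = (\<lambda>p. \<Sum>k\<in>Poly_Mapping.keys p. Poly_Mapping.lookup p k * F k)"
  have L_sup: "L p = (\<Sum>k\<in>K. Poly_Mapping.lookup p k * F k)"
    if "finite K" "Poly_Mapping.keys p \<subseteq> K" for p K
    unfolding L_def using that by (intro sum.mono_neutral_left) (auto simp: in_keys_iff)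
  have L_add: "L (p + q) = L p + L q" for p q
  proof -
    let ?K = "Poly_Mapping.keys p \<union> Poly_Mapping.keys q"
    have "L (p + q) = (\<Sum>k\<in>?K. Poly_Mapping.lookup (p + q) k * F k)"
      by (rule L_sup) (use Poly_Mapping.keys_add[of p q] in auto)
    moreover have "L p = (\<Sum>k\<in>?K. Poly_Mapping.lookup p k * F k)"
      "L q = (\<Sum>k\<in>?K. Poly_Mapping.lookup q k * F k)"
      by (rule L_sup; simp)+
    ultimately show ?thesis by (simp add: lookup_add algebra_simps sum.distrib)
  qed
  have L_single: "L (Poly_Mapping.single k c) = c * F k" for k c
    by (subst L_sup[of "{k}"]) auto
  have L_scale: "L (Poly_Mapping.single [] c * p) = c * L p" for c p
    by (induction p rule: poly_mapping_single_induct)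
       (simp_all add: mult_single plus_list_def L_single L_add algebra_simps)

  have MF: "fold T w G \<in> M" if "G \<in> M" for w G
    using that by (induction w arbitrary: G) (auto simp: M)
  have congF: "fold T w G s = fold T w H s" if "\<And>s. s \<in> R \<Longrightarrow> G s = H s" "s \<in> R" for w G H s
    using that
  proof (induction w arbitrary: G H)
    case (Cons z w)
    have "fold T w (T z G) s = fold T w (T z H) s"
      by (rule Cons.IH) (use Cons.prems cong[of G H] in blast)+
    then show ?case by simp
  qed simp
  have linF: "fold T w (\<lambda>s. c * G s + H s) s = c * fold T w G s + fold T w H s" for w c G H s
  proof (induction w arbitrary: G H)
    case (Cons z w)
    have "T z (\<lambda>s. c * G s + H s) = (\<lambda>s. c * T z G s + T z H s)" by (rule ext) (rule lin)
    then show ?case using Cons by simp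
  qed simp
  have F_lin: "F (u @ z # v) = c * F (u @ x # v) + F (u @ y # v)"
    if "\<And>G s. G \<in> M \<Longrightarrow> s \<in> R \<Longrightarrow> T z G s = c * T x G s + T y G s" for u v x y z c
    using congF[of "T z (fold T u G0)" "\<lambda>s. c * T x (fold T u G0) s + T y (fold T u G0) s" s0 v]
      that[OF MF[OF G0]] s0 by (simp add: F_def linF)
  have F_eq: "F (u @ w @ v) = F (u @ w' @ v)"
    if "\<And>G s. G \<in> M \<Longrightarrow> s \<in> R \<Longrightarrow> fold T w G s = fold T w' G s" for u v w w'
    using congF[of "fold T w (fold T u G0)" "fold T w' (fold T u G0)" s0 v]
      that[OF MF[OF G0]] s0 by (simp add: F_def)
  have F0: "F (u @ Inl 0 # v) = 0" "F (u @ Inr 0 # v) = 0" for u v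
    using F_lin[of "Inl 0" 1 "Inl 0" "Inl 0" u v] lin1[of _ _ 1 0 0]
      F_lin[of "Inr 0" 1 "Inr 0" "Inr 0" u v] lin2[of _ _ 1 0 0]
    by simp_all

  have L_rel: "L (u * p * v) = L (u * q * v)" if "free_product_rel p q" for p q u v
  proof -
    have red: "L (u * p * v) = L (u * q * v)"
      if *: "\<And>k l. L (word k * p * word l) = L (word k * q * word l)" for u v p q
    proof (induction u rule: poly_mapping_single_induct)
      case (single k c)
      show ?case
      proof (induction v rule: poly_mapping_single_induct)
        case (single l d)
        have "L (Poly_Mapping.single k c * r * Poly_Mapping.single l d) = c * (d * L (word k * r * word l))"
          for r
        proof -
          have "Poly_Mapping.single k c = Poly_Mapping.single [] c * word k"
            "Poly_Mapping.single l d = Poly_Mapping.single [] d * word l"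
            by (simp_all add: mult_single plus_list_def)
          then have "Poly_Mapping.single k c * r * Poly_Mapping.single l d =
            Poly_Mapping.single [] c * (Poly_Mapping.single [] d * (word k * r * word l))"
            by (metis mult.assoc scalar_mult_commute)
          then show ?thesis by (simp add: L_scale)
        qed
        then show ?case using * by simp
      qed (simp add: distrib_left L_add)
    qed (simp add: distrib_right L_add)
    have ones: "word k * 1 * word l = word (k @ l)" for k l :: "('a + 'b) list"
      by (simp add: mult_single plus_list_def)
    show ?thesis using that
    proof (induction arbitrary: u v rule: free_product_rel.induct)
      case (fpr_add1 x y)
      show ?case by (rule red) (use F_lin[of "Inl (x + y)" 1 "Inl x" "Inl y"] lin1[of _ _ 1 x y] in
        \<open>simp add: mult_single plus_list_def distrib_left distrib_right L_single L_add\<close>)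
    next
      case (fpr_add2 x y)
      show ?case by (rule red) (use F_lin[of "Inr (x + y)" 1 "Inr x" "Inr y"] lin2[of _ _ 1 x y] in
        \<open>simp add: mult_single plus_list_def distrib_left distrib_right L_single L_add\<close>)
    next
      case (fpr_scale1 c x)
      show ?case by (rule red) (use F_lin[of "Inl (c *\<^sub>C x)" c "Inl x" "Inl 0"] lin1[of _ _ c x 0] in
        \<open>simp add: mult_single plus_list_def L_single F0\<close>)
    next
      case (fpr_scale2 c x)
      show ?case by (rule red) (use F_lin[of "Inr (c *\<^sub>C x)" c "Inr x" "Inr 0"] lin2[of _ _ c x 0] in
        \<open>simp add: mult_single plus_list_def L_single F0\<close>)
    next
      case (fpr_mult1 x y)
      show ?case by (rule red) (use F_eq[of "[Inl (x * y)]" "[Inl x, Inl y]"] mult1 in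
        \<open>simp add: mult_single plus_list_def L_single\<close>)
    next
      case (fpr_mult2 x y)
      show ?case by (rule red) (use F_eq[of "[Inr (x * y)]" "[Inr x, Inr y]"] mult2 in
        \<open>simp add: mult_single plus_list_def L_single\<close>)
    next
      case fpr_one1
      show ?case by (rule red) (use F_eq[of "[Inl 1]" "[]"] one1 in
        \<open>simp add: ones mult_single plus_list_def L_single\<close>)
    next
      case fpr_one2
      show ?case by (rule red) (use F_eq[of "[Inr 1]" "[]"] one2 in
        \<open>simp add: ones mult_single plus_list_def L_single\<close>)
    next
      case (fpr_add p q p' q')
      then show ?case by (simp add: distrib_left distrib_right L_add)
    next
      case (fpr_mult p q p' q')
      show ?case using fpr_mult.IH(1)[of u "p' * v"] fpr_mult.IH(2)[of "u * q" v]
        by (simp only: mult.assoc)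
    next
      case (fpr_sym p q)
      show ?case by (rule fpr_sym.IH[symmetric])
    next
      case (fpr_trans p q r)
      show ?case by (rule trans[OF fpr_trans.IH])
    qed (rule refl)
  qed
  define f where "f = (\<lambda>x. L (rep_free_product x))"
  have f_abs: "f (abs_free_product p) = L p" for p
  proof -
    have "free_product_rel (rep_free_product (abs_free_product p)) p"
      by (rule rep_abs_rsp_left[OF Quotient3_free_product fpr_refl])
    from L_rel[OF this, of 1 1] show ?thesis by (simp add: f_def)
  qed
  have ex_abs: "\<exists>p. x = abs_free_product p" for x :: "('a, 'b) free_product"
    by (metis Quotient_abs_rep Quotient_free_product)
  have "f (x + y) = f x + f y" for x y
    using ex_abs[of x] ex_abs[of y] by (auto simp: plus_free_product.abs_eq f_abs L_add)
  moreover have "f (c *\<^sub>C x) = c * f x" for c x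
    using ex_abs[of x] by (auto simp: scaleC_free_product.abs_eq f_abs L_scale)
  moreover have "f (prod_list (map fp_inj w)) = fold T w G0 s0" for w
    by (simp add: fp_word f_abs L_single F_def)
  ultimately show ?thesis by (auto simp: linear_functional_iff)
qed

lemma unit_coeff_simps:
  assumes A0: "unit_decomposition A0" and ne: "(1::'a::complex_algebra_1) \<noteq> 0"
  shows "\<And>l (a0::'a). a0 \<in> A0 \<Longrightarrow> unit_coeff A0 (l *\<^sub>C 1 + a0) = l"
    and "\<And>a::'a. a - unit_coeff A0 a *\<^sub>C 1 \<in> A0"
proof -
  have sub: "complex_alg.subspace A0" and dis: "range (\<lambda>l. l *\<^sub>C 1) \<inter> A0 = {0}"
    and dec: "\<exists>l. \<exists>a0\<in>A0. a = l *\<^sub>C 1 + a0" for a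
    using A0 by (auto simp: unit_decomposition_def)
  show *: "unit_coeff A0 (l *\<^sub>C 1 + a0) = l" if "a0 \<in> A0" for l a0
    unfolding unit_coeff_def
  proof (rule the_equality)
    show "\<exists>a0'\<in>A0. l *\<^sub>C 1 + a0 = l *\<^sub>C 1 + a0'" using that by auto
  next
    fix m assume "\<exists>a0'\<in>A0. l *\<^sub>C 1 + a0 = m *\<^sub>C 1 + a0'"
    then obtain b where b: "b \<in> A0" "l *\<^sub>C 1 + a0 = m *\<^sub>C 1 + b" by auto
    then have "(m - l) *\<^sub>C 1 = a0 - b" by (simp add: algebra_simps complex_alg.scale_left_diff_distrib)
    moreover have "a0 - b \<in> A0" using sub that b(1) by (rule complex_alg.subspace_diff)
    ultimately have "(m - l) *\<^sub>C (1::'a) \<in> range (\<lambda>l. l *\<^sub>C 1) \<inter> A0"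
      by (metis IntI rangeI)
    then have "(m - l) *\<^sub>C (1::'a) = 0" unfolding dis by simp
    then show "m = l" using ne by simp
  qed
  fix a :: 'a
  obtain l a0 where "a0 \<in> A0" "a = l *\<^sub>C 1 + a0" using dec by blast
  then show "a - unit_coeff A0 a *\<^sub>C 1 \<in> A0" using * by simp
qed

lemma unit_coeff_hom:
  assumes A0: "unit_decomposition A0" and ne: "(1::'a::complex_algebra_1) \<noteq> 0"
  shows "unital_functional (unit_coeff A0)"
    and "unit_coeff A0 (x * y) = unit_coeff A0 x * unit_coeff A0 (y::'a)"
    and "a \<in> A0 \<Longrightarrow> unit_coeff A0 a = 0"
proof -
  note u = unit_coeff_simps[OF A0 ne]
  have sub: "complex_alg.subspace A0" and mul: "\<And>x y. x \<in> A0 \<Longrightarrow> y \<in> A0 \<Longrightarrow> x * y \<in> A0"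
    using A0 by (auto simp: unit_decomposition_def)
  show "a \<in> A0 \<Longrightarrow> unit_coeff A0 a = 0" using u(1)[of a 0] by simp
  have e: "x = unit_coeff A0 x *\<^sub>C 1 + (x - unit_coeff A0 x *\<^sub>C 1)" for x by simp
  have "unit_coeff A0 (x + y) = unit_coeff A0 x + unit_coeff A0 y" for x y
  proof -
    have "x + y = (unit_coeff A0 x + unit_coeff A0 y) *\<^sub>C 1 +
      ((x - unit_coeff A0 x *\<^sub>C 1) + (y - unit_coeff A0 y *\<^sub>C 1))"
      by (simp add: algebra_simps)
    then show ?thesis
      by (metis u complex_alg.subspace_add[OF sub])
  qed
  moreover have "unit_coeff A0 (c *\<^sub>C x) = c * unit_coeff A0 x" for c x
  proof -
    have "c *\<^sub>C x = (c * unit_coeff A0 x) *\<^sub>C 1 + c *\<^sub>C (x - unit_coeff A0 x *\<^sub>C 1)"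
      by (simp add: algebra_simps)
    then show ?thesis
      by (metis u complex_alg.subspace_scale[OF sub])
  qed
  moreover have "unit_coeff A0 1 = 1"
    using u(1)[of 0 1] complex_alg.subspace_0[OF sub] by simp
  ultimately show "unital_functional (unit_coeff A0)"
    by (simp add: unital_functional_def linear_functional_iff)
  let ?x = "x - unit_coeff A0 x *\<^sub>C 1" and ?y = "y - unit_coeff A0 y *\<^sub>C 1"
  have "x * y = (unit_coeff A0 x * unit_coeff A0 y) *\<^sub>C 1 +
    (unit_coeff A0 x *\<^sub>C ?y + unit_coeff A0 y *\<^sub>C ?x + ?x * ?y)"
    by (simp add: algebra_simps mult_scaleC_left mult_scaleC_right)
  moreover have "unit_coeff A0 x *\<^sub>C ?y + unit_coeff A0 y *\<^sub>C ?x + ?x * ?y \<in> A0"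
    by (intro complex_alg.subspace_add[OF sub] complex_alg.subspace_scale[OF sub] mul u)
  ultimately show "unit_coeff A0 (x * y) = unit_coeff A0 x * unit_coeff A0 y"
    by (metis u(1))
qed

lemma monotone_product_ex1:
  fixes \<phi>1 :: "'a::complex_algebra_1 \<Rightarrow> complex" and \<phi>2 :: "'b::complex_algebra_1 \<Rightarrow> complex"
  assumes "unital_functional \<phi>1" "unital_functional \<phi>2" and A0: "unit_decomposition A0"
  shows "\<exists>!\<mu>. is_monotone_product A0 \<phi>1 \<phi>2 \<mu>"
proof -
  note f1 = unital_functionalD[OF assms(1)] and f2 = unital_functionalD[OF assms(2)]
  have ne: "(1::'a) \<noteq> 0" using f1 by force
  define \<delta> where "\<delta> = unit_coeff A0"
  have d: "unital_functional \<delta>" unfolding \<delta>_def by (rule unit_coeff_hom[OF A0 ne])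
  note d1 = unital_functionalD[OF d]
  have dm: "\<delta> (x * y) = \<delta> x * \<delta> y" for x y unfolding \<delta>_def by (rule unit_coeff_hom[OF A0 ne])
  have d0: "\<delta> a = 0" if "a \<in> A0" for a unfolding \<delta>_def by (rule unit_coeff_hom(3)[OF A0 ne that])
  have dA: "a - \<delta> a *\<^sub>C 1 \<in> A0" for a unfolding \<delta>_def by (rule unit_coeff_simps[OF A0 ne])

  define M where "M = {G :: 'a \<times> 'b \<Rightarrow> complex.
    (\<forall>c x x' y. G (c *\<^sub>C x + x', y) = c * G (x, y) + G (x', y)) \<and>
    (\<forall>c x y y'. G (x, c *\<^sub>C y + y') = c * G (x, y) + G (x, y'))}"
  define T where "T = (\<lambda>z G (x, y). case z of
      Inl a \<Rightarrow> G ((a - \<delta> a *\<^sub>C 1) * x, 1) * \<phi>2 y + \<delta> a * G (x, y)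
    | Inr b \<Rightarrow> G (x :: 'a, b * y :: 'b))"
  define G0 where "G0 = (\<lambda>(x, y). \<phi>1 x * \<phi>2 y)"
  have T1: "T (Inl a) G (x, y) = G ((a - \<delta> a *\<^sub>C 1) * x, 1) * \<phi>2 y + \<delta> a * G (x, y)"
    and T2: "T (Inr b) G (x, y) = G (x, b * y)" for a b G x y
    by (simp_all add: T_def)
  have M1: "G (x + x', y) = G (x, y) + G (x', y)" "G (c *\<^sub>C x, y) = c * G (x, y)"
      "G (x - x', y) = G (x, y) - G (x', y)" "G (x, y + y') = G (x, y) + G (x, y')"
      "G (x, c *\<^sub>C y) = c * G (x, y)" if G: "G \<in> M" for G x x' y y' c
  proof -
    have a: "G (c *\<^sub>C x + x', y) = c * G (x, y) + G (x', y)"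
      "G (x, c *\<^sub>C y + y') = c * G (x, y) + G (x, y')" for c x x' y y'
      using G by (auto simp: M_def)
    have z: "G (0, y) = 0" "G (x, 0) = 0" for x y
      using a(1)[of 1 0 0] a(2)[of _ 1 0 0] by simp_all
    show "G (x + x', y) = G (x, y) + G (x', y)" using a(1)[of 1 x x'] by simp
    show "G (c *\<^sub>C x, y) = c * G (x, y)" using a(1)[of c x 0] z by simp
    show "G (x - x', y) = G (x, y) - G (x', y)" using a(1)[of "-1" x' x] by simp
    show "G (x, y + y') = G (x, y) + G (x, y')" using a(2)[of x 1 y y'] by simp
    show "G (x, c *\<^sub>C y) = c * G (x, y)" using a(2)[of x c y 0] z by simp
  qed
  have "\<exists>f. Vector_Spaces.linear (*\<^sub>C) (*) f \<and> (\<forall>w. f (prod_list (map fp_inj w)) = fold T w G0 (1, 1))"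
  proof (rule fp_functional_ex[where M = M and R = UNIV])
    show "G0 \<in> M" by (simp add: M_def G0_def f1 f2 algebra_simps)
    show "T z G \<in> M" if "G \<in> M" for z G
      by (cases z) (simp_all add: M_def T1 T2 M1[OF that] f2 algebra_simps mult_scaleC_right)
  next
    fix G H :: "'a \<times> 'b \<Rightarrow> complex" and z and s :: "'a \<times> 'b"
    assume "\<And>s. s \<in> UNIV \<Longrightarrow> G s = H s"
    then have "G = H" by auto
    then show "T z G s = T z H s" by simp
  next
    fix c G H z and s :: "'a \<times> 'b"
    show "T z (\<lambda>s. c * G s + H s) s = c * T z G s + T z H s"
      by (cases s; cases z) (simp_all add: T1 T2 algebra_simps)
  next
    fix G and s :: "'a \<times> 'b" assume G: "G \<in> M"
    note M1 = M1[OF G]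
    obtain p q where s: "s = (p, q)" by force
    show "T (Inl 1) G s = G s" "T (Inr 1) G s = G s"
      using M1(2)[of 0 0 1] by (simp_all add: s T1 T2 d1)
    show "T (Inl (c *\<^sub>C x + y)) G s = c * T (Inl x) G s + T (Inl y) G s" for c x y
      by (simp add: s T1 d1 M1 algebra_simps mult_scaleC_left
          complex_alg.scale_left_distrib flip: complex_alg.scale_scale)
    show "T (Inr (c *\<^sub>C x + y)) G s = c * T (Inr x) G s + T (Inr y) G s" for c x y
      by (simp add: s T2 M1 algebra_simps mult_scaleC_left)
    show "T (Inl (x * y)) G s = T (Inl y) (T (Inl x) G) s" for x y
      by (simp add: s T1 d1 dm f2 M1 algebra_simps mult_scaleC_left mult_scaleC_right
           flip: complex_alg.scale_scale)
    show "T (Inr (x * y)) G s = T (Inr y) (T (Inr x) G) s" for x y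
      by (simp add: s T2 mult.assoc)
  qed simp_all
  then obtain \<mu> where lin: "Vector_Spaces.linear (*\<^sub>C) (*) \<mu>"
    and \<mu>: "\<And>w. \<mu> (prod_list (map fp_inj w)) = fold T w G0 (1, 1)" by blast
  have uf: "unital_functional \<mu>"
    using lin \<mu>[of "[]"] by (simp add: unital_functional_def G0_def f1 f2)
  have val: "\<mu> (fp_inr b * prod_list (map (\<lambda>(a, b'). fp_inl a * fp_inr b') ps)) =
      \<phi>1 (prod_list (map fst ps)) * (\<phi>2 b * prod_list (map (\<lambda>(a, b'). \<phi>2 b') ps))"
    if ps: "fst ` set ps \<subseteq> A0" for b ps
  proof -
    have "prod_list (map (\<lambda>(a, b'). fp_inl a * fp_inr b') ps) =
      prod_list (map fp_inj (concat (map (\<lambda>(a, b'). [Inl a, Inr b']) ps)))"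
      by (induction ps) (auto simp: mult.assoc)
    then have 1: "fp_inr b * prod_list (map (\<lambda>(a, b'). fp_inl a * fp_inr b') ps) =
      prod_list (map fp_inj (Inr b # concat (map (\<lambda>(a, b'). [Inl a, Inr b']) ps)))"
      by simp
    have 2: "fold T (concat (map (\<lambda>(a, b'). [Inl a, Inr b']) ps)) G (x, 1) =
      G (prod_list (map fst ps) * x, 1) * prod_list (map (\<lambda>(a, b'). \<phi>2 b') ps)"
      if "fst ` set ps \<subseteq> A0" for G x ps
      using that
    proof (induction ps arbitrary: G x rule: rev_induct)
      case (snoc p ps)
      obtain a b' where p: "p = (a, b')" by force
      show ?case using snoc by (simp add: p T1 T2 d0 mult.assoc)
    qed simp
    show ?thesis
      unfolding 1 \<mu> using 2[OF ps, of "T (Inr b) G0" 1] by (simp add: T2 G0_def)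
  qed
  define S :: "('a, 'b) free_product set" where
    "S = {fp_inr b * prod_list (map (\<lambda>(a, b'). fp_inl a * fp_inr b') ps) | b ps. fst ` set ps \<subseteq> A0}"
  have span: "complex_alg.span S = UNIV"
  proof (rule fp_span)
    show "1 \<in> S" unfolding S_def by (rule CollectI, rule exI[of _ 1], rule exI[of _ "[]"])
        (simp add: fp_inj_simps)
    fix z s assume s: "s \<in> S"
    then obtain b ps where ps: "fst ` set ps \<subseteq> A0"
      and s_eq: "s = fp_inr b * prod_list (map (\<lambda>(a, b'). fp_inl a * fp_inr b') ps)"
      by (auto simp: S_def)
    show "fp_inj z * s \<in> complex_alg.span S"
    proof (cases z)
      case (Inl a)
      let ?a = "a - \<delta> a *\<^sub>C 1"
      have "fp_inr 1 * prod_list (map (\<lambda>(a, b'). fp_inl a * fp_inr b') ((?a, b) # ps)) \<in> S"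
        unfolding S_def
        by (rule CollectI, rule exI[of _ 1], rule exI[of _ "(?a, b) # ps"]) (use ps dA in simp)
      then have "fp_inl ?a * s \<in> S" by (simp add: s_eq fp_inj_simps(8) mult.assoc)
      moreover have "fp_inl a = \<delta> a *\<^sub>C 1 + fp_inl ?a"
        using fp_inj_simps(1)[of "\<delta> a *\<^sub>C 1" ?a] by (simp add: fp_inj_simps)
      then have "fp_inl a * s = \<delta> a *\<^sub>C s + fp_inl ?a * s"
        by (metis distrib_right mult_scaleC_left mult_1_left)
      ultimately show ?thesis using s
        by (simp add: Inl complex_alg.span_add complex_alg.span_scale complex_alg.span_base)
    next
      case (Inr b')
      have "fp_inr (b' * b) * prod_list (map (\<lambda>(a, b'). fp_inl a * fp_inr b') ps) \<in> S"
        unfolding S_def using ps by blast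
      then show ?thesis by (simp add: Inr s_eq fp_inj_simps mult.assoc complex_alg.span_base)
    qed
  qed
  show ?thesis
  proof (rule ex1I[of _ \<mu>])
    show "is_monotone_product A0 \<phi>1 \<phi>2 \<mu>" using uf val by (auto simp: is_monotone_product_def)
    fix \<nu> assume \<nu>: "is_monotone_product A0 \<phi>1 \<phi>2 \<nu>"
    then have "unital_functional \<nu>" by (auto simp: is_monotone_product_def)
    then show "\<nu> = \<mu>" using uf span
      by (rule unital_functional_eqI) (use \<nu> val in \<open>auto simp: S_def is_monotone_product_def\<close>)
  qed
qed

lemma centered_alternating_Cons:
  "centered_alternating \<psi>1 \<psi>2 (z # w) \<longleftrightarrow> case_sum \<psi>1 \<psi>2 z = 0 \<and>
     centered_alternating \<psi>1 \<psi>2 w \<and> (w = [] \<or> isl z \<noteq> isl (hd w))"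
  by (cases w) (simp_all add: centered_alternating_def conj_ac)

lemma cfree_functional_ex:
  fixes \<psi>1 :: "'a::complex_algebra_1 \<Rightarrow> complex" and \<psi>2 :: "'b::complex_algebra_1 \<Rightarrow> complex"
  assumes "unital_functional \<psi>1" "unital_functional \<psi>2"
    and G0: "\<And>u v c x y. G0 (u @ Inl (c *\<^sub>C x + y) # v) = c * G0 (u @ Inl x # v) + G0 (u @ Inl y # v)"
      "\<And>u v c x y. G0 (u @ Inr (c *\<^sub>C x + y) # v) = c * G0 (u @ Inr x # v) + G0 (u @ Inr y # v)"
    and G0_Nil: "G0 [] = 1"
  shows "\<exists>f. unital_functional f \<and>
    (\<forall>w. centered_alternating \<psi>1 \<psi>2 w \<longrightarrow> f (prod_list (map fp_inj w)) = G0 w)"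
proof -
  note p1 = unital_functionalD[OF assms(1)] and p2 = unital_functionalD[OF assms(2)]
  let ?alt = "centered_alternating \<psi>1 \<psi>2"
  define R where "R = Collect ?alt"
  define M where "M = {G :: ('a + 'b) list \<Rightarrow> complex.
    (\<forall>u v c x y. u @ Inl x # v \<in> R \<longrightarrow> u @ Inl y # v \<in> R \<longrightarrow>
       G (u @ Inl (c *\<^sub>C x + y) # v) = c * G (u @ Inl x # v) + G (u @ Inl y # v)) \<and>
    (\<forall>u v c x y. u @ Inr x # v \<in> R \<longrightarrow> u @ Inr y # v \<in> R \<longrightarrow>
       G (u @ Inr (c *\<^sub>C x + y) # v) = c * G (u @ Inr x # v) + G (u @ Inr y # v))}"
  define c1 where "c1 = (\<lambda>a. a - \<psi>1 a *\<^sub>C 1)"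
  define c2 where "c2 = (\<lambda>b. b - \<psi>2 b *\<^sub>C 1)"
  have pc: "\<psi>1 (c1 a) = 0" "\<psi>2 (c2 b) = 0" for a b by (simp_all add: c1_def c2_def p1 p2)
  have c_lin: "c1 (c *\<^sub>C a + a') = c *\<^sub>C c1 a + c1 a'" "c2 (c *\<^sub>C b + b') = c *\<^sub>C c2 b + c2 b'"
    for c a a' b b'
    by (simp_all add: c1_def c2_def p1 p2 complex_alg.scale_right_diff_distrib
        complex_alg.scale_left_distrib)
  have c_fix: "\<psi>1 a = 0 \<Longrightarrow> c1 a = a" "\<psi>2 b = 0 \<Longrightarrow> c2 b = b" for a b
    by (simp_all add: c1_def c2_def)
  have c_one: "c1 1 = 0" "c2 1 = 0" by (simp_all add: c1_def c2_def p1 p2)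
  define T :: "'a + 'b \<Rightarrow> (('a + 'b) list \<Rightarrow> complex) \<Rightarrow> ('a + 'b) list \<Rightarrow> complex" where
    "T = (\<lambda>z G w. case z of
        Inl a \<Rightarrow> if w \<noteq> [] \<and> isl (hd w)
          then G (Inl (c1 (a * projl (hd w))) # tl w) + \<psi>1 (a * projl (hd w)) * G (tl w)
          else G (Inl (c1 a) # w) + \<psi>1 a * G w
      | Inr b \<Rightarrow> if w \<noteq> [] \<and> \<not> isl (hd w)
          then G (Inr (c2 (b * projr (hd w))) # tl w) + \<psi>2 (b * projr (hd w)) * G (tl w)
          else G (Inr (c2 b) # w) + \<psi>2 b * G w)"
  have T_simps:
    "T (Inl a) G (Inl x # w) = G (Inl (c1 (a * x)) # w) + \<psi>1 (a * x) * G w"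
    "T (Inl a) G (Inr y # w) = G (Inl (c1 a) # Inr y # w) + \<psi>1 a * G (Inr y # w)"
    "T (Inl a) G [] = G [Inl (c1 a)] + \<psi>1 a * G []"
    "T (Inr b) G (Inr y # w) = G (Inr (c2 (b * y)) # w) + \<psi>2 (b * y) * G w"
    "T (Inr b) G (Inl x # w) = G (Inr (c2 b) # Inl x # w) + \<psi>2 b * G (Inl x # w)"
    "T (Inr b) G [] = G [Inr (c2 b)] + \<psi>2 b * G []" for a b x y w G
    by (simp_all add: T_def)
  have R_simps:
    "[] \<in> R"
    "Inl x # w \<in> R \<longleftrightarrow> \<psi>1 x = 0 \<and> w \<in> R \<and> (w = [] \<or> \<not> isl (hd w))"
    "Inr y # w \<in> R \<longleftrightarrow> \<psi>2 y = 0 \<and> w \<in> R \<and> (w = [] \<or> isl (hd w))" for x y w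
    by (auto simp: R_def centered_alternating_Cons) (simp add: centered_alternating_def)
  have hd_app: "isl (hd (u @ Inl x # v)) = isl (hd (u @ Inl y # v))"
    "isl (hd (u @ Inr x' # v)) = isl (hd (u @ Inr y' # v))"
    for u v and x y :: 'a and x' y' :: 'b
    by (cases u; simp)+
  have R_lin: "u @ Inl (c *\<^sub>C x + y) # v \<in> R" if "u @ Inl x # v \<in> R" "u @ Inl y # v \<in> R" for u c x y v
    using that
  proof (induction u)
    case (Cons z u)
    then show ?case using hd_app(1)[of u _ v] by (cases z) (auto simp: R_simps)
  qed (auto simp: R_simps p1)
  have R_lin': "u @ Inr (c *\<^sub>C x + y) # v \<in> R" if "u @ Inr x # v \<in> R" "u @ Inr y # v \<in> R" for u c x y v
    using that
  proof (induction u)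
    case (Cons z u)
    then show ?case using hd_app(2)[of u _ v] by (cases z) (auto simp: R_simps)
  qed (auto simp: R_simps p2)
  have M1: "G (u @ Inl (c *\<^sub>C x + y) # v) = c * G (u @ Inl x # v) + G (u @ Inl y # v)"
    if "G \<in> M" "u @ Inl x # v \<in> R" "u @ Inl y # v \<in> R" for G u v c x y
    using that by (auto simp: M_def)
  have M2: "G (u @ Inr (c *\<^sub>C x + y) # v) = c * G (u @ Inr x # v) + G (u @ Inr y # v)"
    if "G \<in> M" "u @ Inr x # v \<in> R" "u @ Inr y # v \<in> R" for G u v c x y
    using that by (auto simp: M_def)
  have M1h: "G (Inl (c *\<^sub>C x + y) # v) = c * G (Inl x # v) + G (Inl y # v)"
    if "G \<in> M" "v \<in> R" "v = [] \<or> \<not> isl (hd v)" "\<psi>1 x = 0" "\<psi>1 y = 0" for G v c x y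
    using M1[of G "[]" x v y c] that by (simp add: R_simps)
  have M2h: "G (Inr (c *\<^sub>C x + y) # v) = c * G (Inr x # v) + G (Inr y # v)"
    if "G \<in> M" "v \<in> R" "v = [] \<or> isl (hd v)" "\<psi>2 x = 0" "\<psi>2 y = 0" for G v c x y
    using M2[of G "[]" x v y c] that by (simp add: R_simps)
  have M0: "G (Inl 0 # v) = 0" if "G \<in> M" "v \<in> R" "v = [] \<or> \<not> isl (hd v)" for G v
    using M1h[OF that, of 0 0 1] by (simp add: p1)
  have M0': "G (Inr 0 # v) = 0" if "G \<in> M" "v \<in> R" "v = [] \<or> isl (hd v)" for G v
    using M2h[OF that, of 0 0 1] by (simp add: p2)

  have TM: "T z G \<in> M" if G: "G \<in> M" for z G
  proof -
    have *: "T z G (u @ Inl (c *\<^sub>C x + y) # v) = c * T z G (u @ Inl x # v) + T z G (u @ Inl y # v)"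
      if r: "u @ Inl x # v \<in> R" "u @ Inl y # v \<in> R" for u v c x y
    proof (cases u)
      case Nil
      show ?thesis
      proof (cases z)
        case (Inl a)
        have e: "a * (c *\<^sub>C x + y) = c *\<^sub>C (a * x) + a * y"
          by (simp add: distrib_left mult_scaleC_right)
        show ?thesis using r
          by (simp add: Inl Nil T_simps e c_lin p1 M1h[OF G] R_simps pc) (simp add: distrib_left distrib_right)
      next
        case (Inr b)
        show ?thesis using r M1[OF G, of "[Inr (c2 b)]" x v y c]
          by (simp add: Inr Nil T_simps R_simps pc M1h[OF G] distrib_left)
      qed
    next
      case (Cons z' u')
      have r': "u' @ Inl x # v \<in> R" "u' @ Inl y # v \<in> R"
        and h: "isl z' \<noteq> isl (hd (u' @ Inl x # v))" "isl z' \<noteq> isl (hd (u' @ Inl y # v))"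
        using r by (cases z'; simp add: Cons R_simps)+
      show ?thesis
      proof (cases z)
        case zl: (Inl a)
        show ?thesis
        proof (cases z')
          case (Inl x')
          show ?thesis
            using M1[OF G, of "Inl (c1 (a * x')) # u'" x v y c] M1[OF G r', of c] r' h
            by (simp add: Cons zl Inl T_simps R_simps pc distrib_left distrib_right)
        next
          case (Inr x')
          show ?thesis
            using M1[OF G, of "Inl (c1 a) # u" x v y c] M1[OF G r, of c] r
            by (simp add: Cons zl Inr T_simps R_simps pc distrib_left distrib_right)
        qed
      next
        case zr: (Inr b)
        show ?thesis
        proof (cases z')
          case (Inr x')
          show ?thesis
            using M1[OF G, of "Inr (c2 (b * x')) # u'" x v y c] M1[OF G r', of c] r' h
            by (simp add: Cons zr Inr T_simps R_simps pc distrib_left distrib_right)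
        next
          case (Inl x')
          show ?thesis
            using M1[OF G, of "Inr (c2 b) # u" x v y c] M1[OF G r, of c] r
            by (simp add: Cons zr Inl T_simps R_simps pc distrib_left distrib_right)
        qed
      qed
    qed
    have "T z G (u @ Inr (c *\<^sub>C x + y) # v) = c * T z G (u @ Inr x # v) + T z G (u @ Inr y # v)"
      if r: "u @ Inr x # v \<in> R" "u @ Inr y # v \<in> R" for u v c x y
    proof (cases u)
      case Nil
      show ?thesis
      proof (cases z)
        case (Inr a)
        have e: "a * (c *\<^sub>C x + y) = c *\<^sub>C (a * x) + a * y"
          by (simp add: distrib_left mult_scaleC_right)
        show ?thesis using r
          by (simp add: Inr Nil T_simps e c_lin p2 M2h[OF G] R_simps pc) (simp add: distrib_left distrib_right)
      next
        case (Inl b)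
        show ?thesis using r M2[OF G, of "[Inl (c1 b)]" x v y c]
          by (simp add: Inl Nil T_simps R_simps pc M2h[OF G] distrib_left)
      qed
    next
      case (Cons z' u')
      have r': "u' @ Inr x # v \<in> R" "u' @ Inr y # v \<in> R"
        and h: "isl z' \<noteq> isl (hd (u' @ Inr x # v))" "isl z' \<noteq> isl (hd (u' @ Inr y # v))"
        using r by (cases z'; simp add: Cons R_simps)+
      show ?thesis
      proof (cases z)
        case zl: (Inl a)
        show ?thesis
        proof (cases z')
          case (Inl x')
          show ?thesis
            using M2[OF G, of "Inl (c1 (a * x')) # u'" x v y c] M2[OF G r', of c] r' h
            by (simp add: Cons zl Inl T_simps R_simps pc distrib_left distrib_right)
        next
          case (Inr x')
          show ?thesis
            using M2[OF G, of "Inl (c1 a) # u" x v y c] M2[OF G r, of c] r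
            by (simp add: Cons zl Inr T_simps R_simps pc distrib_left distrib_right)
        qed
      next
        case zr: (Inr b)
        show ?thesis
        proof (cases z')
          case (Inr x')
          show ?thesis
            using M2[OF G, of "Inr (c2 (b * x')) # u'" x v y c] M2[OF G r', of c] r' h
            by (simp add: Cons zr Inr T_simps R_simps pc distrib_left distrib_right)
        next
          case (Inl x')
          show ?thesis
            using M2[OF G, of "Inr (c2 b) # u" x v y c] M2[OF G r, of c] r
            by (simp add: Cons zr Inl T_simps R_simps pc distrib_left distrib_right)
        qed
      qed
    qed
    with * show ?thesis by (simp add: M_def)
  qed
  have side: "(\<exists>x v. w = Inl x # v \<and> \<psi>1 x = 0 \<and> v \<in> R \<and> (v = [] \<or> \<not> isl (hd v))) \<or>
      (\<exists>y v. w = Inr y # v \<and> \<psi>2 y = 0 \<and> v \<in> R \<and> (v = [] \<or> isl (hd v))) \<or> w = []" if "w \<in> R" for w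
  proof (cases w)
    case (Cons z v)
    then show ?thesis using that by (cases z) (auto simp: R_simps)
  qed simp

  have "\<exists>f. Vector_Spaces.linear (*\<^sub>C) (*) f \<and> (\<forall>w. f (prod_list (map fp_inj w)) = fold T w G0 [])"
  proof (rule fp_functional_ex[where M = M and R = R])
    show "G0 \<in> M" by (simp add: M_def G0)
    show "T z G \<in> M" if "G \<in> M" for z G using TM that .
    show "[] \<in> R" by (simp add: R_simps)
  next
    fix G H :: "('a + 'b) list \<Rightarrow> complex" and z s assume e: "\<And>s. s \<in> R \<Longrightarrow> G s = H s" and s: "s \<in> R"
    show "T z G s = T z H s"
      using side[OF s] s by (cases z) (auto simp: T_simps R_simps pc e)
  next
    fix c z s and G H :: "('a + 'b) list \<Rightarrow> complex"
    show "T z (\<lambda>s. c * G s + H s) s = c * T z G s + T z H s"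
      by (cases z) (auto simp: T_def algebra_simps)
  next
    fix G :: "('a + 'b) list \<Rightarrow> complex" and s assume G: "G \<in> M" and s: "s \<in> R"
    note sd = side[OF s]
    show "T (Inl 1) G s = G s" "T (Inr 1) G s = G s"
      using sd s by (auto simp: T_simps p1 p2 c_fix c_one M0[OF G] M0'[OF G] R_simps)
    show "T (Inl (c *\<^sub>C x + y)) G s = c * T (Inl x) G s + T (Inl y) G s" for c x y
      using sd s by (auto simp: T_simps distrib_right mult_scaleC_left c_lin p1 M1h[OF G] pc R_simps
          distrib_left)
    show "T (Inr (c *\<^sub>C x + y)) G s = c * T (Inr x) G s + T (Inr y) G s" for c x y
      using sd s by (auto simp: T_simps distrib_right mult_scaleC_left c_lin p2 M2h[OF G] pc R_simps
          distrib_left)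
    have e1: "G (Inl (c1 (x * p)) # v) = \<psi>1 p * G (Inl (c1 x) # v) + G (Inl (c1 (x * c1 p)) # v)"
      "\<psi>1 (x * p) = \<psi>1 p * \<psi>1 x + \<psi>1 (x * c1 p)"
      if "v \<in> R" "v = [] \<or> \<not> isl (hd v)" for x p v
    proof -
      have e: "x * p = \<psi>1 p *\<^sub>C x + x * c1 p"
        by (simp add: c1_def right_diff_distrib mult_scaleC_right)
      have "c1 (x * p) = \<psi>1 p *\<^sub>C c1 x + c1 (x * c1 p)" by (subst e) (rule c_lin)
      then show "G (Inl (c1 (x * p)) # v) = \<psi>1 p * G (Inl (c1 x) # v) + G (Inl (c1 (x * c1 p)) # v)"
        using M1h[OF G that] by (simp add: pc)
      show "\<psi>1 (x * p) = \<psi>1 p * \<psi>1 x + \<psi>1 (x * c1 p)" by (subst e) (simp add: p1)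
    qed
    have e2: "G (Inr (c2 (x * p)) # v) = \<psi>2 p * G (Inr (c2 x) # v) + G (Inr (c2 (x * c2 p)) # v)"
      "\<psi>2 (x * p) = \<psi>2 p * \<psi>2 x + \<psi>2 (x * c2 p)"
      if "v \<in> R" "v = [] \<or> isl (hd v)" for x p v
    proof -
      have e: "x * p = \<psi>2 p *\<^sub>C x + x * c2 p"
        by (simp add: c2_def right_diff_distrib mult_scaleC_right)
      have "c2 (x * p) = \<psi>2 p *\<^sub>C c2 x + c2 (x * c2 p)" by (subst e) (rule c_lin)
      then show "G (Inr (c2 (x * p)) # v) = \<psi>2 p * G (Inr (c2 x) # v) + G (Inr (c2 (x * c2 p)) # v)"
        using M2h[OF G that] by (simp add: pc)
      show "\<psi>2 (x * p) = \<psi>2 p * \<psi>2 x + \<psi>2 (x * c2 p)" by (subst e) (simp add: p2)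
    qed
    have Tl: "T (Inl a) G v = G (Inl (c1 a) # v) + \<psi>1 a * G v"
      if "v = [] \<or> \<not> isl (hd v)" for a v using that by (auto simp: T_def)
    have Tr: "T (Inr a) G v = G (Inr (c2 a) # v) + \<psi>2 a * G v"
      if "v = [] \<or> isl (hd v)" for a v using that by (auto simp: T_def)
    show "T (Inl (x * y)) G s = T (Inl y) (T (Inl x) G) s" for x y
    proof -
      have "T (Inl (x * y)) G (Inl p # v) = T (Inl y) (T (Inl x) G) (Inl p # v)"
        if v: "v \<in> R" "v = [] \<or> \<not> isl (hd v)" for p v
        using e1[OF v, of x "y * p"]
        by (simp add: T_simps(1) Tl[OF v(2)] mult.assoc algebra_simps)
      moreover have "T (Inl (x * y)) G v = T (Inl y) (T (Inl x) G) v"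
        if v: "v \<in> R" "v = [] \<or> \<not> isl (hd v)" for v
      proof -
        have "T (Inl y) (T (Inl x) G) v = T (Inl x) G (Inl (c1 y) # v) + \<psi>1 y * T (Inl x) G v"
          using v(2) by (auto simp: T_def)
        then show ?thesis using e1[OF v, of x y]
          by (simp add: T_simps(1) Tl[OF v(2)] algebra_simps)
      qed
      ultimately show ?thesis using sd s by auto
    qed
    show "T (Inr (x * y)) G s = T (Inr y) (T (Inr x) G) s" for x y
    proof -
      have "T (Inr (x * y)) G (Inr p # v) = T (Inr y) (T (Inr x) G) (Inr p # v)"
        if v: "v \<in> R" "v = [] \<or> isl (hd v)" for p v
        using e2[OF v, of x "y * p"]
        by (simp add: T_simps(4) Tr[OF v(2)] mult.assoc algebra_simps)
      moreover have "T (Inr (x * y)) G v = T (Inr y) (T (Inr x) G) v"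
        if v: "v \<in> R" "v = [] \<or> isl (hd v)" for v
      proof -
        have "T (Inr y) (T (Inr x) G) v = T (Inr x) G (Inr (c2 y) # v) + \<psi>2 y * T (Inr x) G v"
          using v(2) by (auto simp: T_def)
        then show ?thesis using e2[OF v, of x y]
          by (simp add: T_simps(4) Tr[OF v(2)] algebra_simps)
      qed
      ultimately show ?thesis using sd s by auto
    qed
  qed
  then obtain f where lin: "Vector_Spaces.linear (*\<^sub>C) (*) f"
    and f: "\<And>w. f (prod_list (map fp_inj w)) = fold T w G0 []" by blast
  have "fold T u G0 v = G0 (u @ v)" if "u @ v \<in> R" for u v
    using that
  proof (induction u arbitrary: v rule: rev_induct)
    case (snoc z u)
    have zv: "z # v \<in> R"
      using snoc.prems
    proof (induction u)
      case (Cons z' u)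
      then show ?case by (cases z') (simp_all add: R_simps)
    qed simp
    then have v: "v \<in> R" by (cases z) (simp_all add: R_simps)
    have "T z (fold T u G0) v = fold T u G0 (z # v)"
      using zv by (cases z) (auto simp: T_def R_simps c_fix)
    then show ?case using snoc by simp
  qed simp
  from this[of _ "[]"] have "f (prod_list (map fp_inj w)) = G0 w" if "?alt w" for w
    using that by (simp add: f R_def)
  moreover have "unital_functional f"
    using lin f[of "[]"] by (simp add: unital_functional_def G0_Nil)
  ultimately show ?thesis by blast
qed

lemma centered_alternating_span:
  fixes \<psi>1 :: "'a::complex_algebra_1 \<Rightarrow> complex" and \<psi>2 :: "'b::complex_algebra_1 \<Rightarrow> complex"
  assumes "unital_functional \<psi>1" "unital_functional \<psi>2"
  shows "complex_alg.span {prod_list (map fp_inj w) | w. centered_alternating \<psi>1 \<psi>2 w} = UNIV"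
    (is "complex_alg.span ?S = _")
proof (rule fp_span)
  note p1 = unital_functionalD[OF assms(1)] and p2 = unital_functionalD[OF assms(2)]
  let ?alt = "centered_alternating \<psi>1 \<psi>2"
  have S: "prod_list (map fp_inj w) \<in> complex_alg.span ?S" if "?alt w" for w
    by (rule complex_alg.span_base) (use that in auto)
  show "1 \<in> ?S" by (rule CollectI, rule exI[of _ "[]"]) (simp add: centered_alternating_def)
  fix z s assume "s \<in> ?S"
  then obtain w where w: "?alt w" and s: "s = prod_list (map fp_inj w)" by auto
  have l: "fp_inl a * prod_list (map fp_inj v) \<in> complex_alg.span ?S"
    if "?alt v" "v = [] \<or> \<not> isl (hd v)" for a v
  proof -
    let ?a = "a - \<psi>1 a *\<^sub>C 1"
    have "fp_inl a = \<psi>1 a *\<^sub>C 1 + fp_inl ?a"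
      using fp_inj_simps(1)[of "\<psi>1 a *\<^sub>C 1" ?a] by (simp add: fp_inj_simps)
    then have "fp_inl a * prod_list (map fp_inj v) =
      \<psi>1 a *\<^sub>C prod_list (map fp_inj v) + fp_inl ?a * prod_list (map fp_inj v)"
      by (metis distrib_right mult_scaleC_left mult_1_left)
    moreover have "fp_inl ?a * prod_list (map fp_inj v) \<in> complex_alg.span ?S"
      using S[of "Inl ?a # v"] that by (simp add: centered_alternating_Cons p1)
    ultimately show ?thesis
      by (simp add: complex_alg.span_add complex_alg.span_scale S that(1))
  qed
  have r: "fp_inr b * prod_list (map fp_inj v) \<in> complex_alg.span ?S"
    if "?alt v" "v = [] \<or> isl (hd v)" for b v
  proof -
    let ?b = "b - \<psi>2 b *\<^sub>C 1"
    have "fp_inr b = \<psi>2 b *\<^sub>C 1 + fp_inr ?b"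
      using fp_inj_simps(2)[of "\<psi>2 b *\<^sub>C 1" ?b] by (simp add: fp_inj_simps)
    then have "fp_inr b * prod_list (map fp_inj v) =
      \<psi>2 b *\<^sub>C prod_list (map fp_inj v) + fp_inr ?b * prod_list (map fp_inj v)"
      by (metis distrib_right mult_scaleC_left mult_1_left)
    moreover have "fp_inr ?b * prod_list (map fp_inj v) \<in> complex_alg.span ?S"
      using S[of "Inr ?b # v"] that by (simp add: centered_alternating_Cons p2)
    ultimately show ?thesis
      by (simp add: complex_alg.span_add complex_alg.span_scale S that(1))
  qed
  show "fp_inj z * s \<in> complex_alg.span ?S"
  proof (cases w)
    case Nil
    then show ?thesis using l[of "[]"] r[of "[]"] w s by (cases z) simp_all
  next
    case (Cons y v)
    have v: "?alt v" "v = [] \<or> isl y \<noteq> isl (hd v)" using w by (simp_all add: Cons centered_alternating_Cons)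
    show ?thesis
    proof (cases z)
      case zl: (Inl a)
      show ?thesis
      proof (cases y)
        case (Inl x)
        then show ?thesis using l[of v "a * x"] v by (simp add: zl s Cons fp_inj_simps mult.assoc)
      next
        case (Inr x)
        then show ?thesis using l[of w a] w by (simp add: zl s Cons)
      qed
    next
      case zr: (Inr b)
      show ?thesis
      proof (cases y)
        case (Inr x)
        then show ?thesis using r[of v "b * x"] v by (simp add: zr s Cons fp_inj_simps mult.assoc)
      next
        case (Inl x)
        then show ?thesis using r[of w b] w by (simp add: zr s Cons)
      qed
    qed
  qed
qed

lemma cfree_product_ex1:
  fixes \<phi>1 \<psi>1 :: "'a::complex_algebra_1 \<Rightarrow> complex" and \<phi>2 \<psi>2 :: "'b::complex_algebra_1 \<Rightarrow> complex"
  assumes "unital_functional \<phi>1" "unital_functional \<psi>1" "unital_functional \<phi>2" "unital_functional \<psi>2"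
  shows "\<exists>!p. is_cfree_product \<phi>1 \<psi>1 \<phi>2 \<psi>2 p"
proof -
  note f1 = unital_functionalD[OF assms(1)] and f2 = unital_functionalD[OF assms(3)]
  let ?alt = "centered_alternating \<psi>1 \<psi>2"
  have "\<exists>f. unital_functional f \<and> (\<forall>w. ?alt w \<longrightarrow>
      f (prod_list (map fp_inj w)) = prod_list (map (case_sum \<phi>1 \<phi>2) w))"
    by (rule cfree_functional_ex[OF assms(2,4)]) (simp_all add: f1 f2 algebra_simps)
  then obtain \<phi> where \<phi>: "unital_functional \<phi>"
    "\<And>w. ?alt w \<Longrightarrow> \<phi> (prod_list (map fp_inj w)) = prod_list (map (case_sum \<phi>1 \<phi>2) w)" by blast
  have "\<exists>f. unital_functional f \<and> (\<forall>w. ?alt w \<longrightarrow>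
      f (prod_list (map fp_inj w)) = (if w = [] then 1 else 0))"
    by (rule cfree_functional_ex[OF assms(2,4)]) simp_all
  then obtain \<psi> where \<psi>: "unital_functional \<psi>"
    "\<And>w. ?alt w \<Longrightarrow> \<psi> (prod_list (map fp_inj w)) = (if w = [] then 1 else 0)" by blast
  note span = centered_alternating_span[OF assms(2,4)]
  show ?thesis
  proof (rule ex1I[of _ "(\<phi>, \<psi>)"])
    show "is_cfree_product \<phi>1 \<psi>1 \<phi>2 \<psi>2 (\<phi>, \<psi>)" using \<phi> \<psi> by (simp add: is_cfree_product_def)
    fix p assume "is_cfree_product \<phi>1 \<psi>1 \<phi>2 \<psi>2 p"
    then obtain f g where p: "p = (f, g)" "unital_functional f" "unital_functional g"
      "\<And>w. w \<noteq> [] \<Longrightarrow> ?alt w \<Longrightarrow> f (prod_list (map fp_inj w)) = prod_list (map (case_sum \<phi>1 \<phi>2) w)"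
      "\<And>w. w \<noteq> [] \<Longrightarrow> ?alt w \<Longrightarrow> g (prod_list (map fp_inj w)) = 0"
      by (cases p) (auto simp: is_cfree_product_def)
    have "f (prod_list (map fp_inj w)) = \<phi> (prod_list (map fp_inj w)) \<and>
        g (prod_list (map fp_inj w)) = \<psi> (prod_list (map fp_inj w))" if "?alt w" for w
      using that p(4,5) \<phi>(2) \<psi>(2) unital_functionalD(3)[OF p(2)] unital_functionalD(3)[OF p(3)]
        unital_functionalD(3)[OF \<phi>(1)] unital_functionalD(3)[OF \<psi>(1)]
      by (cases "w = []") simp_all
    then have "f = \<phi>" "g = \<psi>"
      using unital_functional_eqI[OF p(2) \<phi>(1) span] unital_functional_eqI[OF p(3) \<psi>(1) span]
      by blast+
    then show "p = (\<phi>, \<psi>)" by (simp add: p)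
  qed
qed

end

(* The alternating words whose letters lie in A0 or in the kernel of \<phi>2 span the free product, so it
   suffices to compare the two functionals on them. After padding such a word with units of the second
   algebra, the monotone product sends it to \<phi>1 of the product of its first-algebra letters times the
   values of \<phi>2 at its second-algebra letters. Both functionals thus vanish as soon as a letter of the
   second algebra occurs, and the only remaining nonempty words are single letters a from A0, where
   both take the value \<phi>1 a. *)

theory Submission
  imports Defs
begin

text \<open>Induction from the left: units of the second algebra fill the places where the pattern b
  a b' ... a b'' lacks a letter, and \<open>f 1 = 1\<close> keeps them from changing the product of
  values. The clause \<open>b = 1\<close> strengthens the induction: it records that the leading
  factor is mere padding, hence replaceable.\<close>

lemma alternating_word_monotone_form:
  fixes w :: "('a::complex_algebra_1 + 'b::complex_algebra_1) list" and f :: "'b \<Rightarrow> complex"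
  assumes "successively (\<lambda>x y. isl x \<noteq> isl y) w" and "Inl -` set w \<subseteq> A0" and "f 1 = 1"
  shows "\<exists>b ps. fst ` set ps \<subseteq> A0 \<and> (w = [] \<or> isl (hd w) \<longrightarrow> b = 1) \<and>
    prod_list (map fp_inj w) = fp_inr b * prod_list (map (\<lambda>(a, b'). fp_inl a * fp_inr b') ps) \<and>
    prod_list (map fst ps) = prod_list (map (case_sum id (\<lambda>_. 1)) w) \<and>
    f b * prod_list (map (\<lambda>(a, b'). f b') ps) = prod_list (map (case_sum (\<lambda>_. 1) f) w)"
  using assms(1,2)
proof (induction w)
  case Nil
  show ?case
    by (rule exI[of _ 1], rule exI[of _ "[]"]) (simp add: fp_inj_simps assms(3))
next
  case (Cons z w)
  have "Inl -` set w \<subseteq> A0" using Cons.prems(2) by auto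
  moreover have "successively (\<lambda>x y. isl x \<noteq> isl y) w" "w = [] \<or> isl z \<noteq> isl (hd w)"
    using Cons.prems(1) by (simp_all add: successively_Cons) auto
  ultimately obtain b ps where ps: "fst ` set ps \<subseteq> A0" "w = [] \<or> isl (hd w) \<Longrightarrow> b = 1"
    "prod_list (map fp_inj w) = fp_inr b * prod_list (map (\<lambda>(a, b'). fp_inl a * fp_inr b') ps)"
    "prod_list (map fst ps) = prod_list (map (case_sum id (\<lambda>_. 1)) w)"
    "f b * prod_list (map (\<lambda>(a, b'). f b') ps) = prod_list (map (case_sum (\<lambda>_. 1) f) w)"
    and alt: "w = [] \<or> isl z \<noteq> isl (hd w)"
    using Cons.IH by blast
  show ?case
  proof (cases z)
    case (Inl a)
    then have "a \<in> A0" using Cons.prems(2) by auto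
    \<comment> \<open>The old leading factor \<open>b\<close> becomes the right partner of
      \<open>a\<close>, and a fresh unit leads.\<close>
    then show ?thesis
      by (intro exI[of _ 1] exI[of _ "(a, b) # ps"])
         (simp add: Inl ps(1,3,4) ps(5)[symmetric] fp_inj_simps assms(3) mult.assoc)
  next
    case (Inr b')
    \<comment> \<open>By alternation \<open>w\<close> is empty or starts in the first algebra, so
      its leading factor is the padding unit and \<open>b'\<close> can take its place.\<close>
    then have "b = 1" using alt ps(2) by auto
    then show ?thesis
      using ps by (intro exI[of _ b'] exI[of _ ps]) (simp add: Inr fp_inj_simps assms(3))
  qed
qed

lemma monotone_product_alternating:
  assumes "is_monotone_product A0 \<phi>1 \<phi>2 \<mu>" and "\<phi>2 1 = 1"
    and "successively (\<lambda>x y. isl x \<noteq> isl y) w" and "Inl -` set w \<subseteq> A0"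
  shows "\<mu> (prod_list (map fp_inj w)) =
    \<phi>1 (prod_list (map (case_sum id (\<lambda>_. 1)) w)) * prod_list (map (case_sum (\<lambda>_. 1) \<phi>2) w)"
proof -
  obtain b ps where ps: "fst ` set ps \<subseteq> A0"
    "prod_list (map fp_inj w) = fp_inr b * prod_list (map (\<lambda>(a, b'). fp_inl a * fp_inr b') ps)"
    "prod_list (map fst ps) = prod_list (map (case_sum id (\<lambda>_. 1)) w)"
    "\<phi>2 b * prod_list (map (\<lambda>(a, b'). \<phi>2 b') ps) = prod_list (map (case_sum (\<lambda>_. 1) \<phi>2) w)"
    using alternating_word_monotone_form[OF assms(3,4), where f = \<phi>2, OF assms(2)] by blast
  have "\<mu> (fp_inr b * prod_list (map (\<lambda>(a, b'). fp_inl a * fp_inr b') ps)) =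
      \<phi>1 (prod_list (map fst ps)) * (\<phi>2 b * prod_list (map (\<lambda>(a, b'). \<phi>2 b') ps))"
    using assms(1) ps(1) by (simp add: is_monotone_product_def)
  then show ?thesis by (simp only: ps)
qed

theorem proposition3p1:
  fixes \<phi>1 :: "'a::complex_algebra_1 \<Rightarrow> complex"
    and \<phi>2 :: "'b::complex_algebra_1 \<Rightarrow> complex"
    and A0 :: "'a set"
  assumes "unital_functional \<phi>1" and "unital_functional \<phi>2"
    and "unit_decomposition A0"
  shows "monotone_product A0 \<phi>1 \<phi>2 = fst (cfree_product \<phi>1 (unit_coeff A0) \<phi>2 \<phi>2)"
proof -
  let ?\<delta> = "unit_coeff A0" and ?\<mu> = "monotone_product A0 \<phi>1 \<phi>2"
  let ?\<phi> = "fst (cfree_product \<phi>1 ?\<delta> \<phi>2 \<phi>2)"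
  note f1 = unital_functionalD[OF assms(1)] and f2 = unital_functionalD[OF assms(2)]
  have ne: "(1::'a) \<noteq> 0" using f1 by force
  have \<delta>: "unital_functional ?\<delta>" by (rule unit_coeff_hom[OF assms(3) ne])
  \<comment> \<open>Centered letters of the first algebra are thus admissible in the monotone
    formula.\<close>
  have A0: "a \<in> A0" if "?\<delta> a = 0" for a
    using unit_coeff_simps(2)[OF assms(3) ne, of a] that by simp
  have \<mu>: "is_monotone_product A0 \<phi>1 \<phi>2 ?\<mu>"
    unfolding monotone_product_def by (rule theI'[OF monotone_product_ex1[OF assms]])
  have "is_cfree_product \<phi>1 ?\<delta> \<phi>2 \<phi>2 (cfree_product \<phi>1 ?\<delta> \<phi>2 \<phi>2)"
    unfolding cfree_product_def
    by (rule theI'[OF cfree_product_ex1[OF assms(1) \<delta> assms(2,2)]])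
  then have \<phi>: "unital_functional ?\<phi>"
    and \<phi>_word: "\<And>w. w \<noteq> [] \<Longrightarrow> centered_alternating ?\<delta> \<phi>2 w \<Longrightarrow>
      ?\<phi> (prod_list (map fp_inj w)) = prod_list (map (case_sum \<phi>1 \<phi>2) w)"
    by (auto simp: is_cfree_product_def split: prod.splits)
  have \<mu>u: "unital_functional ?\<mu>" using \<mu> by (simp add: is_monotone_product_def)
  have "?\<mu> (prod_list (map fp_inj w)) = ?\<phi> (prod_list (map fp_inj w))"
    if w: "centered_alternating ?\<delta> \<phi>2 w" for w
  proof (cases "w = []")
    case True
    \<comment> \<open>The conditionally free condition covers nonempty words only; here unitality
      gives 1 on both sides.\<close>
    then show ?thesis by (simp add: unital_functionalD(3)[OF \<mu>u] unital_functionalD(3)[OF \<phi>])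
  next
    case False
    have alt: "successively (\<lambda>x y. isl x \<noteq> isl y) w"
      and cen: "\<And>z. z \<in> set w \<Longrightarrow> case_sum ?\<delta> \<phi>2 z = 0"
      using w by (auto simp: centered_alternating_def)
    have "Inl -` set w \<subseteq> A0" using cen A0 by force
    note \<mu>_word = monotone_product_alternating[where w = w, OF \<mu> f2(3) alt this]
    show ?thesis
    proof (cases "\<exists>b. Inr b \<in> set w")
      case True
      \<comment> \<open>Being centered for \<phi>2, this letter puts a zero factor into both
        values.\<close>
      then obtain b where b: "Inr b \<in> set w" "\<phi>2 b = 0" using cen by fastforce
      then have "prod_list (map (case_sum (\<lambda>_. 1) \<phi>2) w) = 0"
        "prod_list (map (case_sum \<phi>1 \<phi>2) w) = 0"
        by (force simp: prod_list_zero_iff)+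
      then show ?thesis using \<mu>_word \<phi>_word[OF False w] by simp
    next
      case no_Inr: False
      then obtain a v where v: "w = Inl a # v" using False
        by (metis list.exhaust list.set_intros(1) sum.exhaust)
      \<comment> \<open>A second letter would also come from the first algebra, against
        alternation.\<close>
      have "v = []"
      proof (cases v)
        case (Cons z u)
        then show ?thesis using alt v no_Inr by (cases z) auto
      qed simp
      then show ?thesis using \<mu>_word \<phi>_word[OF False w] v by simp
    qed
  qed
  then show ?thesis
    by (intro unital_functional_eqI[OF \<mu>u \<phi> centered_alternating_span[OF \<delta> assms(2)]]) auto
qed

end
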